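(* Let $n$ be a positive integer, let $\xi\in\mathbb{F}_{2^n}$ with $\xi\neq 0$, and let $f:\mathbb{F}_{2^n}\to\mathbb{F}_{2^n}$ be a mapping with $f(0)=0$ and image $\mathrm{Im}(f)=\{0,\xi\}$. Then $f$ is a planar function on $\mathbb{F}_{2^n}$ if and only if $f$ is additive, i.e. $f(x+y)=f(x)+f(y)$ for all $x,y\in\mathbb{F}_{2^n}$.
   Context: A function $f:\mathbb{F}_{2^n}\to\mathbb{F}_{2^n}$ is called planar if for every nonzero $a\in\mathbb{F}_{2^n}$ the map $x\mapsto f(x+a)+f(x)+xa$ is a permutation of $\mathbb{F}_{2^n}$. *)

theory Defs
  imports "HOL-Library.Cardinality"
begin

(* Planarity in the characteristic-2 sense; used below only for fields of order 2^n. *)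
definition planar :: "('a::{field,finite} \<Rightarrow> 'a) \<Rightarrow> bool" where
  "planar f \<longleftrightarrow> (\<forall>a. a \<noteq> 0 \<longrightarrow> bij (\<lambda>x. f (x + a) + f x + x * a))"

end

theory Submission
  imports Defs "HOL-Algebra.Exponent" "HOL-Computational_Algebra.Polynomial"
begin

text \<open>
  Planarity of \<open>f\<close> means that the derivatives of \<open>f\<close> in directions \<open>a\<close> and \<open>\<xi> / a\<close> compose to
  zero for all \<open>a\<close>; writing \<open>\<xi> = c\<^sup>2\<close>, the function \<open>g x = f (c x)\<close> satisfies this with \<open>1\<close> in
  place of \<open>\<xi>\<close>. This property is inherited by derivatives, so by descent on the degree it suffices
  to treat a function with vanishing third derivatives. Its second derivative is an alternating
  biadditive form \<open>B\<close> with \<open>B(a, 1/a) = 0\<close>. Expand \<open>B(x, y)\<close> as a sum of terms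
  \<open>C\<^sub>i\<^sub>j x ^ 2 ^ i * y ^ 2 ^ j\<close>. The exponents \<open>2 ^ i - 2 ^ j\<close> with \<open>i \<noteq> j\<close> are distinct and
  nonzero modulo \<open>2 ^ n - 1\<close>, so \<open>B(x, 1/x) = 0\<close> kills the off-diagonal coefficients. Hence \<open>B(x, y)\<close>
  depends only on \<open>x y = s\<^sup>2\<close>, and \<open>B(x, y) = B(s, s) = 0\<close>.
\<close>

section \<open>Finite fields of characteristic two\<close>

lemma power_card_minus_1_eq_1:
  fixes x :: "'a::{field,finite}"
  assumes "x \<noteq> 0"
  shows "x ^ (CARD('a) - 1) = 1"
proof -
  have "x ^ (CARD('a) - 1) * \<Prod>(UNIV - {0}) = (\<Prod>y\<in>UNIV - {0}. x * y)"
    by (simp add: prod.distrib)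
  also have "\<dots> = \<Prod>(UNIV - {0})"
    by (rule prod.reindex_bij_witness[of _ "\<lambda>y. y / x" "\<lambda>y. x * y"]) (use assms in auto)
  finally show ?thesis by simp
qed

lemma of_nat_card_eq_0: "of_nat (CARD('a::{field,finite})) = (0 :: 'a)"
proof -
  have "(\<Sum>x\<in>(UNIV :: 'a set). x) = (\<Sum>x\<in>UNIV. x + 1)"
    by (rule sum.reindex_bij_witness[of _ "\<lambda>x. x + 1" "\<lambda>x. x - 1"]) auto
  then show ?thesis by (simp add: sum.distrib)
qed

lemma add_self_eq_0:
  fixes x :: "'a::{field,finite}"
  assumes "CARD('a) = 2 ^ n"
  shows "x + x = 0"
proof -
  have "CHAR('a) dvd 2 ^ n"
    using of_nat_card_eq_0[where 'a='a] assms by (simp only: of_nat_eq_0_iff_char_dvd)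
  moreover have "prime CHAR('a)"
    by (intro prime_CHAR_semidom finite_imp_CHAR_pos) simp
  ultimately have "CHAR('a) = 2"
    using prime_dvd_power primes_dvd_imp_eq two_is_prime_nat by blast
  then show ?thesis
    by (metis mult_2 mult_zero_left of_nat_CHAR of_nat_numeral)
qed

lemma add_self_left:
  fixes x y :: "'a::{field,finite}"
  assumes "CARD('a) = 2 ^ n"
  shows "x + (x + y) = y"
  by (simp add: add_self_eq_0[OF assms] flip: add.assoc)

lemma add_eq_0_imp_eq:
  fixes x y :: "'a::{field,finite}"
  assumes "CARD('a) = 2 ^ n" "x + y = 0"
  shows "x = y"
  using add_self_left[OF assms(1), of x y] assms(2) by simp

lemma of_nat_card_minus_1:
  assumes "CARD('a::{field,finite}) = 2 ^ n"
  shows "of_nat (CARD('a) - 1) = (1 :: 'a)"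
proof -
  have "of_nat (CARD('a) - 1) + (1 :: 'a) = of_nat (CARD('a) - 1 + 1)"
    by (simp only: of_nat_add of_nat_1)
  also have "CARD('a) - 1 + 1 = CARD('a)" by simp
  finally show ?thesis
    by (metis add_self_eq_0[OF assms] add_right_cancel of_nat_card_eq_0)
qed

text \<open>The root is \<open>z ^ (2 ^ (n - 1))\<close>, because
  \<open>z ^ (2 ^ n) = z\<close>.\<close>

lemma square_surj:
  fixes z :: "'a::{field,finite}"
  assumes card: "CARD('a) = 2 ^ n"
  obtains s where "s * s = z"
proof -
  have "n \<noteq> 0"
  proof
    assume "n = 0"
    then have "card (UNIV :: 'a set) = 1" using card by simp
    then show False by (metis card_1_singletonE UNIV_I singletonD zero_neq_one)
  qed
  have "z ^ (2 ^ n) = z"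
  proof (cases "z = 0")
    case False
    then have "z * z ^ (2 ^ n - 1) = z"
      using power_card_minus_1_eq_1[of z] card by simp
    then show ?thesis by (simp flip: power_Suc)
  qed simp
  moreover have "z ^ (2 ^ (n - 1)) * z ^ (2 ^ (n - 1)) = z ^ (2 ^ n)"
    using \<open>n \<noteq> 0\<close> by (cases n) (simp_all flip: power_add mult_2)
  ultimately show ?thesis using that by metis
qed

section \<open>Power sums over the multiplicative group\<close>

text \<open>As \<open>x ^ m - 1\<close> has at most \<open>m\<close> roots, some nonzero
  \<open>g\<close> has \<open>g ^ m \<noteq> 1\<close>; substituting \<open>g * x\<close> for
  \<open>x\<close> multiplies the sum by \<open>g ^ m\<close>.\<close>

lemma sum_power_eq_0:
  fixes m :: nat
  assumes "0 < m" "m < CARD('a) - 1"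
  shows "(\<Sum>x\<in>UNIV - {0::'a::{field,finite}}. x ^ m) = 0"
proof -
  have "\<exists>g::'a. g \<noteq> 0 \<and> g ^ m \<noteq> 1"
  proof (rule ccontr)
    assume "\<nexists>g::'a. g \<noteq> 0 \<and> g ^ m \<noteq> 1"
    then have "monom 1 m = (1 :: 'a poly)"
      using assms
      by (intro poly_eqI_degree[of "UNIV - {0}"]) (auto simp: poly_monom degree_monom_eq)
    then show False
      using assms(1) by (metis degree_1 degree_monom_eq less_irrefl zero_neq_one)
  qed
  then obtain g :: 'a where g: "g \<noteq> 0" "g ^ m \<noteq> 1" by blast
  have "(\<Sum>x\<in>UNIV - {0::'a}. x ^ m) = (\<Sum>x\<in>UNIV - {0}. (g * x) ^ m)"
    by (rule sum.reindex_bij_witness[of _ "\<lambda>x. g * x" "\<lambda>x. x / g"]) (use g in auto)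
  also have "\<dots> = g ^ m * (\<Sum>x\<in>UNIV - {0}. x ^ m)"
    by (simp add: power_mult_distrib sum_distrib_left)
  finally show ?thesis using g(2) by simp
qed

lemma sum_power_inverse_power_eq_0:
  fixes m k :: nat
  assumes "m \<noteq> k" "m < k + (CARD('a) - 1)" "k < m + (CARD('a) - 1)"
  shows "(\<Sum>x\<in>UNIV - {0::'a::{field,finite}}. x ^ m * inverse x ^ k) = 0"
proof (cases "k < m")
  case True
  have "(\<Sum>x\<in>UNIV - {0::'a}. x ^ m * inverse x ^ k) = (\<Sum>x\<in>UNIV - {0}. x ^ (m - k))"
    using True by (intro sum.cong) (auto simp: power_diff field_simps)
  then show ?thesis using sum_power_eq_0[of "m - k", where 'a='a] True assms by auto
next
  case False
  have "(\<Sum>x\<in>UNIV - {0::'a}. x ^ m * inverse x ^ k) = (\<Sum>x\<in>UNIV - {0}. inverse x ^ (k - m))"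
    using False by (intro sum.cong) (auto simp: power_diff field_simps)
  also have "\<dots> = (\<Sum>x\<in>UNIV - {0::'a}. x ^ (k - m))"
    by (rule sum.reindex_bij_witness[of _ inverse inverse]) auto
  finally show ?thesis using sum_power_eq_0[of "k - m", where 'a='a] False assms by auto
qed

section \<open>Additive maps as linearized polynomials\<close>

text \<open>If \<open>k = 2 ^ i * u\<close> with \<open>u > 1\<close> odd, then
  \<open>k choose 2 ^ i\<close> is odd, so \<open>(x + 1) ^ k\<close> has a middle term of degree
  \<open>2 ^ i\<close>, which additivity excludes.\<close>

lemma additive_power_imp_exponent_power_of_2:
  fixes k :: nat
  assumes card: "CARD('a::{field,finite}) = 2 ^ n"
    and k: "0 < k" "k < 2 ^ n"
    and add: "\<And>x y::'a. (x + y) ^ k = x ^ k + y ^ k"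
  shows "\<exists>i<n. k = 2 ^ i"
proof -
  define i where "i = multiplicity 2 k"
  obtain u where u: "k = 2 ^ i * u" "\<not> 2 dvd u"
    using multiplicity_decompose'[of k 2] k i_def by auto
  have "u = 1"
  proof (rule ccontr)
    assume "u \<noteq> 1"
    then have "u > 1" using u(2) by (cases u) auto
    then have lt: "2 ^ i < k" using u(1) by simp
    \<comment> \<open>Both degrees are below the field size, so agreement at every point
      suffices.\<close>
    have "[:1, 1:] ^ k = monom 1 k + (1 :: 'a poly)"
    proof (rule poly_eqI_degree[of UNIV])
      show "degree ([:1, 1:] ^ k :: 'a poly) < card (UNIV :: 'a set)"
        using k card by (simp add: degree_power_eq)
      have "degree (monom 1 k + (1 :: 'a poly)) \<le> k"
        by (intro degree_add_le) (auto simp: degree_monom_le)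
      then show "degree (monom 1 k + (1 :: 'a poly)) < card (UNIV :: 'a set)"
        using k card by simp
    qed (use add in \<open>auto simp: poly_monom\<close>)
    then have "coeff ([:1, 1:] ^ k) (2 ^ i) = coeff (monom 1 k + (1 :: 'a poly)) (2 ^ i)"
      by simp
    moreover have "coeff ([:1, 1:] ^ k :: 'a poly) (2 ^ i) = of_nat (k choose 2 ^ i)"
      using lt by (simp add: coeff_linear_poly_power)
    ultimately have zero: "of_nat (k choose 2 ^ i) = (0 :: 'a)"
      using lt by (simp add: coeff_1)
    have "multiplicity 2 (k choose 2 ^ i) = multiplicity 2 u"
      unfolding u(1) using u(2) by (intro const_p_fac) (auto intro: gr0I)
    then have "multiplicity 2 (k choose 2 ^ i) = 0"
      using u(2) by (simp add: not_dvd_imp_multiplicity_0)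
    then have "odd (k choose 2 ^ i)"
      using lt multiplicity_gt_zero_iff[of "k choose 2 ^ i" 2] by auto
    then obtain r where "k choose 2 ^ i = 2 * r + 1" by (elim oddE)
    then have "of_nat (k choose 2 ^ i) = (of_nat r + of_nat r + 1 :: 'a)" by simp
    then show False using zero add_self_eq_0[OF card] by simp
  qed
  then show ?thesis using u k by auto
qed

text \<open>The isotypic component of \<open>L\<close> for the character \<open>x ^ k\<close> of the multiplicative group. For
  additive \<open>L\<close> it is an additive multiple of \<open>x ^ k\<close>, hence zero unless \<open>k\<close> is a power of two.\<close>

definition frob_coeff :: "nat \<Rightarrow> ('a::{field,finite} \<Rightarrow> 'a) \<Rightarrow> 'a" where
  "frob_coeff k L = (\<Sum>t\<in>UNIV - {0}. inverse t ^ k * L t)"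

text \<open>Each \<open>L (t * x)\<close> is additive in \<open>x\<close> when \<open>L\<close> is
  additive, so this form makes the additivity of the component visible.\<close>

lemma frob_coeff_times_power:
  fixes L :: "'a::{field,finite} \<Rightarrow> 'a"
  assumes "x \<noteq> 0"
  shows "frob_coeff k L * x ^ k = (\<Sum>t\<in>UNIV - {0}. inverse t ^ k * L (t * x))"
proof -
  have "frob_coeff k L * x ^ k = (\<Sum>t\<in>UNIV - {0}. inverse (t / x) ^ k * L t)"
    using assms by (auto simp: frob_coeff_def sum_distrib_left sum_distrib_right field_simps intro!: sum.cong)
  also have "\<dots> = (\<Sum>t\<in>UNIV - {0}. inverse t ^ k * L (t * x))"
    by (rule sum.reindex_bij_witness[of _ "\<lambda>t. t * x" "\<lambda>t. t / x"]) (use assms in auto)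
  finally show ?thesis .
qed

text \<open>Fourier inversion on the multiplicative group: the components for all characters sum to
  \<open>L\<close>, and those whose exponent is not a power of two vanish.\<close>

lemma additive_eq_linearized:
  fixes L :: "'a::{field,finite} \<Rightarrow> 'a"
  assumes card: "CARD('a) = 2 ^ n"
    and add: "\<And>x y. L (x + y) = L x + L y"
  shows "L x = (\<Sum>i<n. frob_coeff (2 ^ i) L * x ^ (2 ^ i))"
proof -
  let ?c = "\<lambda>k. frob_coeff k L"
  have L0: "L 0 = 0" using add[of 0 0] by (metis add_cancel_left_left)
  have c0: "?c k = 0" if k: "k \<in> {1..2 ^ n - 1}" "k \<notin> (\<lambda>i. 2 ^ i) ` {..<n}" for k
  proof (rule ccontr)
    assume nz: "?c k \<noteq> 0"
    have eq: "?c k * x ^ k = (\<Sum>t\<in>UNIV - {0}. inverse t ^ k * L (t * x))" for x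
      using frob_coeff_times_power[of x k L] L0 k(1) by (cases "x = 0") auto
    have "?c k * (x + y) ^ k = ?c k * (x ^ k + y ^ k)" for x y
      unfolding distrib_left[of "?c k"] eq by (simp add: distrib_left add sum.distrib)
    then have "(x + y) ^ k = x ^ k + y ^ k" for x y :: 'a using nz by simp
    moreover have "0 < k" "k < 2 ^ n" using k(1) unfolding atLeastAtMost_iff by linarith+
    ultimately show False
      using additive_power_imp_exponent_power_of_2[OF card] k(2) by blast
  qed
  \<comment> \<open>The \<open>2 ^ n - 1\<close> ones at \<open>z = 1\<close> sum to
    \<open>1\<close> in characteristic two, so the inversion has no normalizing factor.\<close>
  have geom: "(\<Sum>k=1..2 ^ n - 1. z ^ k) = (if z = 1 then 1 else 0)" if "z \<noteq> 0" for z :: 'a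
  proof (cases "z = 1")
    case True
    have "of_nat (2 ^ n - 1) = (1 :: 'a)"
      using of_nat_card_minus_1[OF card] card by simp
    then show ?thesis using True by simp
  next
    case False
    have "(\<Sum>k=1..2 ^ n - 1. z ^ k) = z * (\<Sum>k<2 ^ n - 1. z ^ k)"
      unfolding sum_distrib_left
      by (rule sum.reindex_bij_witness[of _ Suc "\<lambda>k. k - 1"]) (auto simp flip: power_Suc)
    also have "(\<Sum>k<2 ^ n - 1. z ^ k) = 0"
      using power_card_minus_1_eq_1[OF that] False card by (simp add: geometric_sum)
    finally show ?thesis using False by simp
  qed
  show ?thesis
  proof (cases "x = 0")
    case True
    then show ?thesis using L0 by (simp add: power_0_left)
  next
    case False
    have "(\<Sum>i<n. ?c (2 ^ i) * x ^ (2 ^ i)) = (\<Sum>k\<in>(\<lambda>i. 2 ^ i) ` {..<n}. ?c k * x ^ k)"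
      by (subst sum.reindex) (auto simp: inj_on_def)
    also have "\<dots> = (\<Sum>k=1..2 ^ n - 1. ?c k * x ^ k)"
    proof (rule sum.mono_neutral_left)
      have "1 \<le> (2::nat) ^ i \<and> 2 ^ i \<le> 2 ^ n - (1::nat)" if "i < n" for i
        using power_strict_increasing[OF that, of "2::nat"] one_le_power[of "2::nat" i] by linarith
      then show "(\<lambda>i. 2 ^ i) ` {..<n} \<subseteq> {1..2 ^ n - (1::nat)}" by auto
    qed (use c0 in auto)
    also have "\<dots> = (\<Sum>k=1..2 ^ n - 1. \<Sum>t\<in>UNIV - {0}. L t * (x / t) ^ k)"
      unfolding frob_coeff_def sum_distrib_right
      by (intro sum.cong refl) (auto simp: field_simps)
    also have "\<dots> = (\<Sum>t\<in>UNIV - {0}. L t * (\<Sum>k=1..2 ^ n - 1. (x / t) ^ k))"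
      by (subst sum.swap) (simp add: sum_distrib_left)
    also have "\<dots> = (\<Sum>t\<in>UNIV - {0}. if t = x then L t else 0)"
      using False by (intro sum.cong refl, subst geom) auto
    also have "\<dots> = L x" using False by simp
    finally show ?thesis by simp
  qed
qed

text \<open>By uniqueness of binary expansions the multisets of exponents agree, and
  \<open>a \<noteq> b\<close> leaves one matching. The equation is
  \<open>2 ^ i - 2 ^ j = 2 ^ a - 2 ^ b\<close> freed of subtraction.\<close>

lemma sum_two_powers_eq:
  fixes a b i j :: nat
  assumes "(2::nat) ^ i + 2 ^ b = 2 ^ j + 2 ^ a" "a \<noteq> b"
  shows "i = a \<and> j = b"
proof -
  have le: "v \<le> z" if "(2::nat) ^ u + 2 ^ v = 2 ^ w + 2 ^ z" "u \<le> v" "w \<le> z" for u v w z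
  proof (rule ccontr)
    assume "\<not> v \<le> z"
    then have "(2::nat) ^ Suc z \<le> 2 ^ v" by (intro power_increasing) auto
    moreover have "(2::nat) ^ w \<le> 2 ^ z" using that by (intro power_increasing) auto
    moreover have "(2::nat) ^ u > 0" by simp
    ultimately show False using that(1) unfolding power_Suc by linarith
  qed
  have eq: "v = z \<and> u = w" if "(2::nat) ^ u + 2 ^ v = 2 ^ w + 2 ^ z" "u \<le> v" "w \<le> z" for u v w z
  proof -
    have "v = z" using le[of u v w z] le[of w z u v] that by simp
    then show ?thesis using that(1) by simp
  qed
  show ?thesis
    using eq[of i b j a] eq[of i b a j] eq[of b i j a] eq[of b i a j] assms
    by (metis add.commute nle_le)
qed

section \<open>Alternating forms\<close>

lemma alternating_form_eq_0:
  fixes B :: "'a::{field,finite} \<Rightarrow> 'a \<Rightarrow> 'a"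
  assumes card: "CARD('a) = 2 ^ n"
    and addl: "\<And>x y z. B (x + y) z = B x z + B y z"
    and addr: "\<And>x y z. B x (y + z) = B x y + B x z"
    and alt: "\<And>x. B x x = 0"
    and inv: "\<And>x. x \<noteq> 0 \<Longrightarrow> B x (inverse x) = 0"
  shows "B x y = 0"
proof -
  define C where "C i j = frob_coeff (2 ^ j) (\<lambda>y. frob_coeff (2 ^ i) (\<lambda>x. B x y))" for i j :: nat
  have "frob_coeff k (\<lambda>x. B x (y + z)) = frob_coeff k (\<lambda>x. B x y) + frob_coeff k (\<lambda>x. B x z)"
    for k y z by (simp add: frob_coeff_def addr distrib_left sum.distrib)
  then have coeff: "frob_coeff (2 ^ i) (\<lambda>x. B x y) = (\<Sum>j<n. C i j * y ^ (2 ^ j))" for i y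
    unfolding C_def by (rule additive_eq_linearized[OF card])
  have B: "B x y = (\<Sum>i<n. \<Sum>j<n. C i j * x ^ (2 ^ i) * y ^ (2 ^ j))" for x y
  proof -
    have "B x y = (\<Sum>i<n. frob_coeff (2 ^ i) (\<lambda>x. B x y) * x ^ (2 ^ i))"
      by (rule additive_eq_linearized[OF card]) (rule addl)
    then show ?thesis by (simp add: coeff sum_distrib_left sum_distrib_right mult_ac)
  qed
  have C0: "C a b = 0" if ab: "a < n" "b < n" "a \<noteq> b" for a b
  proof -
    \<comment> \<open>Weighting by \<open>x ^ (2 ^ b) * inverse x ^ (2 ^ a)\<close> and summing over
      nonzero \<open>x\<close> isolates \<open>C a b\<close>.\<close>
    let ?S = "\<lambda>i j. \<Sum>x\<in>UNIV - {0::'a}. x ^ (2 ^ i + 2 ^ b) * inverse x ^ (2 ^ j + 2 ^ a)"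
    have S: "?S i j = (if i = a \<and> j = b then 1 else 0)" if ij: "i < n" "j < n" for i j
    proof (cases "i = a \<and> j = b")
      case True
      have "?S i j = (\<Sum>x\<in>UNIV - {0::'a}. x ^ 0)"
        using True by (intro sum.cong) (auto simp: field_simps)
      also have "\<dots> = of_nat (CARD('a) - 1)" by simp
      also have "\<dots> = 1" by (rule of_nat_card_minus_1[OF card])
      finally show ?thesis using True by simp
    next
      case False
      have ne: "(2::nat) ^ i + 2 ^ b \<noteq> 2 ^ j + 2 ^ a"
        using sum_two_powers_eq ab(3) False by blast
      \<comment> \<open>Both exponents lie between \<open>2\<close> and \<open>2 ^ n\<close>, so
        they differ by less than \<open>2 ^ n - 1\<close>.\<close>
      have half: "2 * 2 ^ m \<le> (2::nat) ^ n" if "m < n" for m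
        using power_increasing[of "Suc m" n "2::nat"] that by simp
      have pos: "(1::nat) \<le> 2 ^ m" for m by simp
      have "?S i j = 0"
        using ne half[OF ab(1)] half[OF ab(2)] half[OF ij(1)] half[OF ij(2)]
          pos[of a] pos[of b] pos[of i] pos[of j]
        by (intro sum_power_inverse_power_eq_0) (unfold card, linarith+)
      then show ?thesis using False by simp
    qed
    have "0 = (\<Sum>x\<in>UNIV - {0}. B x (inverse x) * x ^ (2 ^ b) * inverse x ^ (2 ^ a))"
      by (simp add: inv)
    also have "\<dots> = (\<Sum>x\<in>UNIV - {0::'a}. \<Sum>i<n. \<Sum>j<n.
        C i j * (x ^ (2 ^ i + 2 ^ b) * inverse x ^ (2 ^ j + 2 ^ a)))"
      by (simp add: B sum_distrib_right sum_distrib_left power_add mult_ac)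
    also have "\<dots> = (\<Sum>i<n. \<Sum>j<n. C i j * ?S i j)"
      by (simp add: sum_distrib_left sum.swap[of _ "UNIV - {0}"])
    also have "\<dots> = (\<Sum>i<n. \<Sum>j<n. if i = a \<and> j = b then C i j else 0)"
      by (intro sum.cong refl) (auto simp: S)
    also have "\<dots> = (\<Sum>i<n. if i = a then C i b else 0)"
      using ab(2) by (intro sum.cong refl) auto
    also have "\<dots> = C a b" using ab(1) by simp
    finally show ?thesis by simp
  qed
  have diag: "B x y = (\<Sum>i<n. C i i * (x * y) ^ (2 ^ i))" for x y
  proof -
    have "B x y = (\<Sum>i<n. \<Sum>j<n. if j = i then C i i * (x * y) ^ (2 ^ i) else 0)"
      unfolding B using C0 by (intro sum.cong refl) (auto simp: power_mult_distrib)
    then show ?thesis by simp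
  qed
  obtain s where "s * s = x * y"
    by (rule square_surj[OF card])
  then show ?thesis using diag[of x y] diag[of s s] alt[of s] by simp
qed

section \<open>Iterated derivatives\<close>

text \<open>The plus sign stands for a minus, which is the same in characteristic two.\<close>

definition fdiff :: "'a::ab_group_add \<Rightarrow> ('a \<Rightarrow> 'a) \<Rightarrow> 'a \<Rightarrow> 'a" where
  "fdiff v h = (\<lambda>x. h (x + v) + h x)"

primrec fdiff_vanish :: "nat \<Rightarrow> ('a::ab_group_add \<Rightarrow> 'a) \<Rightarrow> bool" where
  "fdiff_vanish 0 h \<longleftrightarrow> (\<forall>x. h x = 0)"
| "fdiff_vanish (Suc k) h \<longleftrightarrow> (\<forall>v. fdiff_vanish k (fdiff v h))"

lemma fdiff_commute: "fdiff v (fdiff w h) = fdiff w (fdiff v h)"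
  by (auto simp: fdiff_def add_ac)

lemma fdiff_zero: "fdiff v (\<lambda>x. 0) = (\<lambda>x. 0)"
  by (simp add: fdiff_def)

lemma fdiff_vanish_zero: "fdiff_vanish k (\<lambda>x. 0)"
  by (induction k) (simp_all add: fdiff_zero)

lemma fdiff_self:
  fixes h :: "'a::{field,finite} \<Rightarrow> 'a"
  assumes "CARD('a) = 2 ^ n"
  shows "fdiff v (fdiff v h) = (\<lambda>x. 0)"
  by (simp add: fdiff_def add_ac add_self_eq_0[OF assms] add_self_left[OF assms])

text \<open>Since \<open>fdiff v\<close> squares to zero, a product of more than \<open>CARD('a)\<close> derivatives
  repeats a direction and hence vanishes; \<open>S\<close> collects the directions already used.\<close>

lemma fdiff_vanish_card:
  fixes h :: "'a::{field,finite} \<Rightarrow> 'a"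
  assumes card: "CARD('a) = 2 ^ n"
    and "\<And>w. w \<in> S \<Longrightarrow> fdiff w h = (\<lambda>x. 0)"
  shows "fdiff_vanish (Suc (card (UNIV - S))) h"
  using assms(2)
proof (induction "card (UNIV - S)" arbitrary: S h)
  case 0
  then have "S = UNIV" by auto
  then show ?case using 0 by simp
next
  case (Suc m)
  have "fdiff_vanish (Suc m) (fdiff v h)" for v
  proof (cases "v \<in> S")
    case True
    then show ?thesis using Suc.prems fdiff_vanish_zero by metis
  next
    case False
    have "UNIV - insert v S = (UNIV - S) - {v}" by auto
    then have m: "m = card (UNIV - insert v S)"
      using Suc.hyps(2) False by simp
    have "fdiff w (fdiff v h) = (\<lambda>x. 0)" if "w \<in> insert v S" for w
      using that Suc.prems[of w] fdiff_self[OF card, of v h]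
      by (auto simp: fdiff_commute[of w v] fdiff_zero)
    then show ?thesis using Suc.hyps(1)[OF m] m by metis
  qed
  then show ?case using Suc.hyps(2) by (metis fdiff_vanish.simps(2))
qed

text \<open>Vanishing third derivatives make the second ones constant in \<open>x\<close>; their
  values form an alternating biadditive form.\<close>

lemma fdiff_vanish_3_imp_2:
  fixes h :: "'a::{field,finite} \<Rightarrow> 'a"
  assumes card: "CARD('a) = 2 ^ n"
    and inv: "\<And>a. a \<noteq> 0 \<Longrightarrow> fdiff a (fdiff (inverse a) h) = (\<lambda>x. 0)"
    and cubic: "fdiff_vanish 3 h"
  shows "fdiff_vanish 2 h"
proof -
  define B where "B a b = fdiff a (fdiff b h) 0" for a b
  have third: "fdiff a (fdiff b (fdiff c h)) x = 0" for a b c x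
    using cubic by (simp add: numeral_3_eq_3)
  have const: "fdiff a (fdiff b h) x = B a b" for a b x
    using third[of x a b 0] unfolding B_def fdiff_def[of x] by (auto intro: add_eq_0_imp_eq[OF card])
  have addl: "B (a + b) c = B a c + B b c" for a b c
  proof -
    \<comment> \<open>The difference along \<open>a + b\<close> telescopes through \<open>b\<close>;
      constancy then removes the base point.\<close>
    have "fdiff (a + b) (fdiff c h) 0 = fdiff a (fdiff c h) b + fdiff b (fdiff c h) 0"
      by (simp add: fdiff_def add_ac add_self_left[OF card])
    then show ?thesis unfolding const .
  qed
  have sym: "B a b = B b a" for a b
    unfolding B_def by (simp add: fdiff_commute)
  have "B a b = 0" for a b
  proof (rule alternating_form_eq_0[where B = B, OF card])
    show "B x (y + z) = B x y + B x z" for x y z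
      using addl[of y z x] by (simp add: sym)
    show "B x x = 0" for x
      unfolding B_def by (simp add: fdiff_self[OF card])
    show "B x (inverse x) = 0" if "x \<noteq> 0" for x
      unfolding B_def by (simp add: inv[OF that])
  qed (rule addl)
  then show ?thesis by (simp add: numeral_2_eq_2 const)
qed

text \<open>Finiteness of the field supplies some order of vanishing, and each application of
  \<open>step\<close> lowers it by one until it is 2.\<close>

lemma fdiff_vanish_2:
  fixes h :: "'a::{field,finite} \<Rightarrow> 'a"
  assumes card: "CARD('a) = 2 ^ n"
    and inv: "\<And>a. a \<noteq> 0 \<Longrightarrow> fdiff a (fdiff (inverse a) h) = (\<lambda>x. 0)"
  shows "fdiff_vanish 2 h"
proof -
  have step: "fdiff_vanish (Suc (Suc k)) h"
    if "fdiff_vanish (Suc (Suc (Suc k))) h"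
      "\<And>a. a \<noteq> 0 \<Longrightarrow> fdiff a (fdiff (inverse a) h) = (\<lambda>x. 0)" for k and h :: "'a \<Rightarrow> 'a"
    using that
  proof (induction k arbitrary: h)
    case 0
    then show ?case
      using fdiff_vanish_3_imp_2[OF card, of h] by (metis numeral_2_eq_2 numeral_3_eq_3)
  next
    case (Suc k)
    have "fdiff_vanish (Suc (Suc k)) (fdiff v h)" for v
    proof (rule Suc.IH)
      show "fdiff_vanish (Suc (Suc (Suc k))) (fdiff v h)"
        using Suc.prems(1) by (metis fdiff_vanish.simps(2))
      show "fdiff a (fdiff (inverse a) (fdiff v h)) = (\<lambda>x. 0)" if "a \<noteq> 0" for a
        using Suc.prems(2)[OF that] by (metis fdiff_commute fdiff_zero)
    qed
    then show ?case by (metis fdiff_vanish.simps(2))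
  qed
  have "fdiff_vanish (Suc (Suc k)) h \<Longrightarrow> fdiff_vanish 2 h" for k
    by (induction k) (use step[OF _ inv] in \<open>auto simp only: numeral_2_eq_2\<close>)
  moreover have "fdiff_vanish (Suc CARD('a)) h"
    using fdiff_vanish_card[OF card, of "{}" h] by simp
  moreover obtain k where "CARD('a) = Suc k"
    by (metis finite_UNIV_card_ge_0 finite gr0_implies_Suc)
  ultimately show ?thesis by metis
qed

section \<open>Planar functions with two values\<close>

theorem theorem4p1:
  fixes n :: nat
    and \<xi> :: "'a::{field,finite}"
    and f :: "'a \<Rightarrow> 'a"
  assumes "n > 0"
    and "CARD('a) = 2 ^ n"
    and "\<xi> \<noteq> 0"
    and "f 0 = 0"
    and "range f = {0, \<xi>}"
  shows "planar f \<longleftrightarrow> (\<forall>x y. f (x + y) = f x + f y)"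
proof
  assume additive: "\<forall>x y. f (x + y) = f x + f y"
  have "bij (\<lambda>x. f (x + a) + f x + x * a)" if "a \<noteq> 0" for a
  proof -
    have "(\<lambda>x. f (x + a) + f x + x * a) = (\<lambda>x. f a + x * a)"
      using additive by (simp add: add_ac add_self_left[OF assms(2)])
    moreover have "inj (\<lambda>x. f a + x * a)"
      using that by (auto simp: inj_on_def)
    ultimately show ?thesis
      by (simp add: bij_def finite_UNIV_inj_surj)
  qed
  then show "planar f" by (simp add: planar_def)
next
  note two = add_self_eq_0[OF assms(2)] and cancel = add_self_left[OF assms(2)]
  assume planar: "planar f"
  \<comment> \<open>The sum is \<open>0\<close> or \<open>\<xi>\<close>. If it were
    \<open>\<xi>\<close>, it would cancel \<open>b * a = \<xi>\<close>, and the planar map for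
    \<open>a\<close> would take the same value at \<open>x\<close> and \<open>x + b\<close>.\<close>
  have zero: "f (x + a + b) + f (x + b) + (f (x + a) + f x) = 0" if ab: "a * b = \<xi>" for a b x
  proof -
    have nz: "a \<noteq> 0" "b \<noteq> 0" using ab assms(3) by auto
    have "inj (\<lambda>x. f (x + a) + f x + x * a)"
      using planar nz(1) by (simp add: planar_def bij_def)
    then have "f (x + b + a) + f (x + b) + (x + b) * a \<noteq> f (x + a) + f x + x * a"
      using nz(2) by (auto dest!: injD)
    moreover have "(x + b) * a = x * a + \<xi>" using ab by (simp add: algebra_simps)
    moreover have "P + (x * a + (P + Q)) = Q + x * a" for P Q
      by (simp add: add_ac cancel)
    ultimately have "f (x + a + b) + f (x + b) + (f (x + a) + f x) \<noteq> \<xi>"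
      by (metis add.assoc add.commute)
    moreover have val: "f y = 0 \<or> f y = \<xi>" for y using assms(5) by blast
    ultimately show ?thesis
      using val[of "x + a + b"] val[of "x + b"] val[of "x + a"] val[of x]
      by (elim disjE) (simp_all add: two cancel)
  qed
  obtain c where c: "c * c = \<xi>" by (rule square_surj[OF assms(2)])
  then have c0: "c \<noteq> 0" using assms(3) by auto
  \<comment> \<open>Scaling by \<open>c\<close> turns direction pairs with product \<open>1\<close>
    into pairs with product \<open>\<xi>\<close>.\<close>
  define g where "g x = f (c * x)" for x
  have "fdiff_vanish 2 g"
  proof (rule fdiff_vanish_2[OF assms(2)])
    fix a :: 'a assume "a \<noteq> 0"
    then have "c * a * (c * inverse a) = \<xi>" using c by (simp add: field_simps)
    from zero[OF this, of "c * x" for x] show "fdiff a (fdiff (inverse a) g) = (\<lambda>x. 0)"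
      by (simp add: fdiff_def g_def distrib_left add_ac)
  qed
  then have "fdiff a (fdiff b g) 0 = 0" for a b by (simp add: numeral_2_eq_2)
  then have "g (a + b) + (g a + g b) = 0" for a b
    using assms(4) by (simp add: fdiff_def g_def add_ac)
  then have g: "g (a + b) = g a + g b" for a b
    by (rule add_eq_0_imp_eq[OF assms(2)])
  show "\<forall>x y. f (x + y) = f x + f y"
  proof (intro allI)
    fix x y
    show "f (x + y) = f x + f y"
      using g[of "x / c" "y / c"] c0 by (simp add: g_def distrib_left)
  qed
qed

end
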